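(* Let $(\overline{\boldsymbol{x}},\overline{\boldsymbol{\nu}}_1,\overline{\boldsymbol{\nu}}_2):U\to D^3\times\Delta$ be a generalized framed surface. Denote $\overline{\boldsymbol{x}}=(x_1,x_2,x_3)$, $\overline{\boldsymbol{\nu}}_1=(y_1,y_2,y_3)$ and $\overline{\boldsymbol{\nu}}_2=(z_1,z_2,z_3)$. Then $(\boldsymbol{x},\boldsymbol{\nu}_1,\boldsymbol{\nu}_2):U\to H^3\times\Delta_5$ is a hyperbolic generalized framed surface, where $$\boldsymbol{x}=\frac{(1+x_1^2+x_2^2+x_3^2,\,2x_1,\,2x_2,\,2x_3)}{1-x_1^2-x_2^2-x_3^2},\quad \boldsymbol{\nu}_1=\frac{(p_1,q_1,r_1,s_1)}{\sqrt{-p_1^2+q_1^2+r_1^2+s_1^2}},\quad \boldsymbol{\nu}_2=\frac{(p_2,q_2,r_2,s_2)}{\sqrt{-p_2^2+q_2^2+r_2^2+s_2^2}},$$ $p_1=2(x_1y_1+x_2y_2+x_3y_3)$, $q_1=(1+x_1^2-x_2^2-x_3^2)y_1+2x_1x_2y_2+2x_1x_3y_3$, $r_1=2x_1x_2y_1+(1-x_1^2+x_2^2-x_3^2)y_2+2x_2x_3y_3$, $s_1=2x_1x_3y_1+2x_2x_3y_2+(1-x_1^2-x_2^2+x_3^2)y_3$, $p_2=2(x_1z_1+x_2z_2+x_3z_3)$, $q_2=(1+x_1^2-x_2^2-x_3^2)z_1+2x_1x_2z_2+2x_1x_3z_3$, $r_2=2x_1x_2z_1+(1-x_1^2+x_2^2-x_3^2)z_2+2x_2x_3z_3$,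 $s_2=2x_1x_3z_1+2x_2x_3z_2+(1-x_1^2-x_2^2+x_3^2)z_3$.
   Context: $\mathbb{R}^4_1$ is $\mathbb{R}^4$ with the pseudo inner product $\langle \boldsymbol{x},\boldsymbol{y}\rangle=-x_1y_1+x_2y_2+x_3y_3+x_4y_4$. The pseudo vector product $\boldsymbol{x}\wedge\boldsymbol{y}\wedge\boldsymbol{z}$ of three vectors of $\mathbb{R}^4_1$ is the unique vector with $\langle \boldsymbol{w},\boldsymbol{x}\wedge\boldsymbol{y}\wedge\boldsymbol{z}\rangle=\det(\boldsymbol{w},\boldsymbol{x},\boldsymbol{y},\boldsymbol{z})$ for all $\boldsymbol{w}\in\mathbb{R}^4_1$. $H^3=\{\boldsymbol{x}\in\mathbb{R}^4_1: \langle\boldsymbol{x},\boldsymbol{x}\rangle=-1,\ x_1>0\}$, $S^3_1=\{\boldsymbol{x}\in\mathbb{R}^4_1:\langle\boldsymbol{x},\boldsymbol{x}\rangle=1\}$, $\Delta_5=\{(\boldsymbol{\nu}_1,\boldsymbol{\nu}_2)\in S^3_1\times S^3_1:\langle\boldsymbol{\nu}_1,\boldsymbol{\nu}_2\rangle=0\}$. $U$ is a simply connected open subset of $\mathbb{R}^2$ with coordinates $(u,v)$; subscripts $u,v$ on maps denote partial derivatives; all maps are $C^\infty$. Hyperbolic generalized framed surface: a smooth map $(\boldsymbol{x},\boldsymbol{\nu}_1,\boldsymbol{\nu}_2):U\to H^3\times\Delta_5$ with $\langle\boldsymbol{x},\boldsymbol{\nu}_1\rangle=\langle\boldsymbol{x},\boldsymbol{\nu}_2\rangle=0$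 on $U$ for which there are smooth functions $\alpha,\beta:U\to\mathbb{R}$ with $\boldsymbol{x}\wedge\boldsymbol{x}_u\wedge\boldsymbol{x}_v=\alpha\boldsymbol{\nu}_1+\beta\boldsymbol{\nu}_2$ on $U$. $\mathbb{R}^3$ is Euclidean 3-space with the usual inner product $\cdot$ and cross product $\times$; $D^3=\{(x_1,x_2,x_3)\in\mathbb{R}^3:x_1^2+x_2^2+x_3^2<1\}$ is regarded as a subset of $\mathbb{R}^3$ with the induced Euclidean metric; $\Delta=\{(\boldsymbol{a},\boldsymbol{b})\in S^2\times S^2:\boldsymbol{a}\cdot\boldsymbol{b}=0\}$ with $S^2$ the unit sphere. A smooth map $(\overline{\boldsymbol{x}},\overline{\boldsymbol{\nu}}_1,\overline{\boldsymbol{\nu}}_2):U\to\mathbb{R}^3\times\Delta$ is a generalized framed surface if there are smooth functions $\overline{\alpha},\overline{\beta}:U\to\mathbb{R}$ with $\overline{\boldsymbol{x}}_u\times\overline{\boldsymbol{x}}_v=\overline{\alpha}\,\overline{\boldsymbol{\nu}}_1+\overline{\beta}\,\overline{\boldsymbol{\nu}}_2$ on $U$. *)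

theory Defs
  imports "HOL-Analysis.Analysis"
begin

(* C^k and C^infinity on an open set: all directional derivatives up to order k
   exist (as values of the Frechet derivative) and are continuous.  Only used on open sets,
   since the derivatives are taken at p and not within the set. *)

primrec Ck_on :: "nat \<Rightarrow> ('a::real_normed_vector \<Rightarrow> 'b::real_normed_vector) \<Rightarrow> 'a set \<Rightarrow> bool" where
  "Ck_on 0 f U \<longleftrightarrow> continuous_on U f"
| "Ck_on (Suc k) f U \<longleftrightarrow> (\<forall>p\<in>U. f differentiable (at p)) \<and>
     (\<forall>d. Ck_on k (\<lambda>p. frechet_derivative f (at p) d) U)"

definition smooth_on :: "('a::real_normed_vector \<Rightarrow> 'b::real_normed_vector) \<Rightarrow> 'a set \<Rightarrow> bool" where
  "smooth_on f U \<longleftrightarrow> (\<forall>k. Ck_on k f U)"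

(* Points of the parameter plane are (u,v) = (p $ 1, p $ 2). *)

definition partial :: "2 \<Rightarrow> (real^2 \<Rightarrow> 'b::real_normed_vector) \<Rightarrow> real^2 \<Rightarrow> 'b" where
  "partial i f p = vector_derivative (\<lambda>t. f (p + t *\<^sub>R axis i 1)) (at 0)"

abbreviation partial_u :: "(real^2 \<Rightarrow> 'b::real_normed_vector) \<Rightarrow> real^2 \<Rightarrow> 'b" where
  "partial_u \<equiv> partial 1"

abbreviation partial_v :: "(real^2 \<Rightarrow> 'b::real_normed_vector) \<Rightarrow> real^2 \<Rightarrow> 'b" where
  "partial_v \<equiv> partial 2"


definition mink :: "real^4 \<Rightarrow> real^4 \<Rightarrow> real" where
  "mink x y = - (x$1 * y$1) + x$2 * y$2 + x$3 * y$3 + x$4 * y$4"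

(* The rows of the matrix are w, x, y, z; the determinant is the same with columns. *)

definition mink_wedge :: "real^4 \<Rightarrow> real^4 \<Rightarrow> real^4 \<Rightarrow> real^4" where
  "mink_wedge x y z = (THE a. \<forall>w. mink w a = det (vector [w, x, y, z] :: real^4^4))"

definition H3 :: "(real^4) set" where
  "H3 = {x. mink x x = -1 \<and> x$1 > 0}"

definition S31 :: "(real^4) set" where
  "S31 = {x. mink x x = 1}"

definition Delta5 :: "((real^4) \<times> (real^4)) set" where
  "Delta5 = {(n1, n2). n1 \<in> S31 \<and> n2 \<in> S31 \<and> mink n1 n2 = 0}"

definition hyperbolic_generalized_framed_surface ::
    "(real^2) set \<Rightarrow> (real^2 \<Rightarrow> real^4) \<Rightarrow> (real^2 \<Rightarrow> real^4) \<Rightarrow> (real^2 \<Rightarrow> real^4) \<Rightarrow> bool" where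
  "hyperbolic_generalized_framed_surface U x n1 n2 \<longleftrightarrow>
     smooth_on (\<lambda>p. (x p, n1 p, n2 p)) U \<and>
     (\<forall>p\<in>U. (x p, n1 p, n2 p) \<in> H3 \<times> Delta5) \<and>
     (\<forall>p\<in>U. mink (x p) (n1 p) = 0 \<and> mink (x p) (n2 p) = 0) \<and>
     (\<exists>\<alpha> \<beta> :: real^2 \<Rightarrow> real. smooth_on \<alpha> U \<and> smooth_on \<beta> U \<and>
        (\<forall>p\<in>U. mink_wedge (x p) (partial_u x p) (partial_v x p)
                = \<alpha> p *\<^sub>R n1 p + \<beta> p *\<^sub>R n2 p))"


definition D3 :: "(real^3) set" where
  "D3 = {x. (x$1)\<^sup>2 + (x$2)\<^sup>2 + (x$3)\<^sup>2 < 1}"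

definition Delta :: "((real^3) \<times> (real^3)) set" where
  "Delta = {(a, b). a \<in> sphere 0 1 \<and> b \<in> sphere 0 1 \<and> a \<bullet> b = 0}"

definition generalized_framed_surface ::
    "(real^2) set \<Rightarrow> (real^2 \<Rightarrow> real^3) \<Rightarrow> (real^2 \<Rightarrow> real^3) \<Rightarrow> (real^2 \<Rightarrow> real^3) \<Rightarrow> bool" where
  "generalized_framed_surface U x n1 n2 \<longleftrightarrow>
     smooth_on (\<lambda>p. (x p, n1 p, n2 p)) U \<and>
     (\<forall>p\<in>U. (n1 p, n2 p) \<in> Delta) \<and>
     (\<exists>\<alpha> \<beta> :: real^2 \<Rightarrow> real. smooth_on \<alpha> U \<and> smooth_on \<beta> U \<and>
        (\<forall>p\<in>U. cross3 (partial_u x p) (partial_v x p)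
                = \<alpha> p *\<^sub>R n1 p + \<beta> p *\<^sub>R n2 p))"


(* Inverse stereographic projection from the Poincare ball to the hyperboloid. *)

definition ball_to_hyperboloid :: "real^3 \<Rightarrow> real^4" where
  "ball_to_hyperboloid x =
     (1 / (1 - (x$1)\<^sup>2 - (x$2)\<^sup>2 - (x$3)\<^sup>2)) *\<^sub>R
       vector [1 + (x$1)\<^sup>2 + (x$2)\<^sup>2 + (x$3)\<^sup>2, 2 * x$1, 2 * x$2, 2 * x$3]"

(* The vector (p, q, r, s); it is (1 - |x|^2)^2 / 2 times the differential of
   ball_to_hyperboloid at x applied to y. *)

definition pqrs :: "real^3 \<Rightarrow> real^3 \<Rightarrow> real^4" where
  "pqrs x y = vector
     [2 * (x$1 * y$1 + x$2 * y$2 + x$3 * y$3),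
      (1 + (x$1)\<^sup>2 - (x$2)\<^sup>2 - (x$3)\<^sup>2) * y$1 + 2 * x$1 * x$2 * y$2 + 2 * x$1 * x$3 * y$3,
      2 * x$1 * x$2 * y$1 + (1 - (x$1)\<^sup>2 + (x$2)\<^sup>2 - (x$3)\<^sup>2) * y$2 + 2 * x$2 * x$3 * y$3,
      2 * x$1 * x$3 * y$1 + 2 * x$2 * x$3 * y$2 + (1 - (x$1)\<^sup>2 - (x$2)\<^sup>2 + (x$3)\<^sup>2) * y$3]"

definition mink_normalize :: "real^4 \<Rightarrow> real^4" where
  "mink_normalize w =
     (1 / sqrt (- (w$1)\<^sup>2 + (w$2)\<^sup>2 + (w$3)\<^sup>2 + (w$4)\<^sup>2)) *\<^sub>R w"

end

theory Submission
  imports Defs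
begin

text \<open>
  The map \<open>F = ball_to_hyperboloid\<close> is the isometry from the Poincare ball model to the hyperboloid
  model. As a map from the Euclidean ball it is conformal: with \<open>\<delta> = 1 - |x|\<^sup>2\<close> (\<open>ball_defect\<close> below)
  its differential is \<open>dF\<^sub>x y = 2/\<delta>\<^sup>2 \<cdot> pqrs x y\<close>, and

  \<^item> \<open>\<langle>pqrs x y, pqrs x z\<rangle> = \<delta>\<^sup>2 (y \<bullet> z)\<close> (\<open>mink_pqrs\<close>);
  \<^item> \<open>\<langle>F x, pqrs x y\<rangle> = 0\<close>, since \<open>\<langle>F, F\<rangle>\<close> is constant (\<open>mink_ball_to_hyperboloid_pqrs\<close>);
  \<^item> \<open>F x \<and> pqrs x a \<and> pqrs x b = - \<delta> pqrs x (a \<times> b)\<close>: the triple product with the position vector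
    as its first factor is, up to sign, the cross product of the tangent space, and a conformal map
    respects cross products up to a factor (\<open>mink_wedge_pqrs\<close>).

  By the first property, the square root that normalises \<open>pqrs x n\<close> for a unit vector \<open>n\<close> is just
  \<open>\<delta>\<close>. Hence the new frame is \<open>\<nu>\<^sub>i = pqrs x n\<^sub>i / \<delta>\<close>: it is smooth, it inherits orthonormality from
  \<open>(n\<^sub>1, n\<^sub>2)\<close>, and it is orthogonal to \<open>F x\<close>. By the chain rule the partial derivatives of \<open>F \<circ> x\<close>
  are \<open>2/\<delta>\<^sup>2 \<cdot> pqrs x x\<^sub>u\<close> and \<open>2/\<delta>\<^sup>2 \<cdot> pqrs x x\<^sub>v\<close>, so by the third property their triple product with
  \<open>F x\<close> is \<open>- 4/\<delta>\<^sup>3 \<cdot> pqrs x (x\<^sub>u \<times> x\<^sub>v)\<close>. Since \<open>pqrs x\<close> is linear, \<open>x\<^sub>u \<times> x\<^sub>v = \<alpha> n\<^sub>1 + \<beta> n\<^sub>2\<close>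
  turns this into \<open>- 4/\<delta>\<^sup>2 (\<alpha> \<nu>\<^sub>1 + \<beta> \<nu>\<^sub>2)\<close>. The new coefficients are therefore \<open>- 4\<alpha>/\<delta>\<^sup>2\<close> and
  \<open>- 4\<beta>/\<delta>\<^sup>2\<close>.

  Smoothness of all these maps follows because they are obtained from the smooth data by sums,
  products and division by \<open>\<delta> > 0\<close>; the closure properties are proved for \<open>Ck_on k\<close> by induction
  on \<open>k\<close>.
\<close>

section \<open>Closure properties of continuously differentiable maps, partial derivatives\<close>

text \<open>Only values on \<open>U\<close> matter, because \<open>U\<close> is open and derivatives are local. The
  normalised vectors of the theorem can therefore be replaced by a formula without a square root.\<close>

lemma Ck_on_cong: "open U \<Longrightarrow> Ck_on k f U \<Longrightarrow> (\<And>p. p\<in>U \<Longrightarrow> f p = g p) \<Longrightarrow> Ck_on k g U"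
proof (induction k arbitrary: f g)
  case 0 then show ?case using continuous_on_cong by (metis Ck_on.simps(1))
next
  case (Suc k)
  have D: "(g has_derivative frechet_derivative f (at p)) (at p)" if "p \<in> U" for p
  proof (rule has_derivative_transform_within_open)
    show "(f has_derivative frechet_derivative f (at p)) (at p)"
      using Suc.prems(2) that frechet_derivative_works by auto
  qed (use Suc.prems that in auto)
  have eq: "frechet_derivative f (at p) = frechet_derivative g (at p)" if "p \<in> U" for p
    using frechet_derivative_at[OF D[OF that]] by simp
  have "Ck_on k (\<lambda>p. frechet_derivative g (at p) d) U" for d
  proof (rule Suc.IH[OF Suc.prems(1)])
    show "Ck_on k (\<lambda>p. frechet_derivative f (at p) d) U"
      using Suc.prems(2) by simp
  qed (simp add: eq)
  then show ?case using D by (auto simp: differentiable_def)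
qed

text \<open>The higher derivatives are hidden behind \<open>frechet_derivative\<close>, a choice operator;
  this rule accepts any explicit formula for the derivative instead. It
  turns each differentiation rule into the induction step of a closure property.\<close>

lemma Ck_on_SucI:
  assumes "open U" and "\<And>p. p \<in> U \<Longrightarrow> (f has_derivative f' p) (at p)"
    and "\<And>d. Ck_on k (\<lambda>p. f' p d) U"
  shows "Ck_on (Suc k) f U"
proof -
  have eq: "f' p = frechet_derivative f (at p)" if "p \<in> U" for p
    using frechet_derivative_at[OF assms(2)[OF that]] .
  have "Ck_on k (\<lambda>p. frechet_derivative f (at p) d) U" for d
    by (rule Ck_on_cong[OF assms(1) assms(3)[of d]]) (simp add: eq)
  then show ?thesis using assms(2) by (auto simp: differentiable_def)
qed

lemma Ck_on_SucD:
  assumes "Ck_on (Suc k) f U"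
  shows "p \<in> U \<Longrightarrow> (f has_derivative frechet_derivative f (at p)) (at p)"
    and "Ck_on k (\<lambda>p. frechet_derivative f (at p) d) U"
  using assms frechet_derivative_works by auto

lemma Ck_on_Suc_imp: "Ck_on (Suc k) f U \<Longrightarrow> Ck_on k f U"
proof (induction k arbitrary: f)
  case 0
  then have "f differentiable_on U"
    by (auto simp: differentiable_on_def intro: differentiable_at_withinI)
  then show ?case by (simp add: differentiable_imp_continuous_on)
next
  case (Suc k) then show ?case by (auto simp del: Ck_on.simps(1))
qed

lemma Ck_on_const: "open U \<Longrightarrow> Ck_on k (\<lambda>p. c) U"
proof (induction k arbitrary: c)
  case (Suc k)
  show ?case
    by (rule Ck_on_SucI[where f' = "\<lambda>p d. 0"]) (use Suc in auto)
qed simp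

lemma Ck_on_linear:
  assumes "open U" "bounded_linear L"
  shows "Ck_on k f U \<Longrightarrow> Ck_on k (\<lambda>p. L (f p)) U"
proof (induction k arbitrary: f)
  case 0 then show ?case
    using bounded_linear.continuous_on[OF assms(2)] by simp
next
  case (Suc k)
  show ?case
    by (rule Ck_on_SucI[OF assms(1) bounded_linear.has_derivative[OF assms(2) Ck_on_SucD(1)[OF Suc.prems]]])
       (auto intro: Suc.IH Ck_on_SucD(2)[OF Suc.prems])
qed

lemma Ck_on_add:
  assumes "open U"
  shows "Ck_on k f U \<Longrightarrow> Ck_on k g U \<Longrightarrow> Ck_on k (\<lambda>p. f p + g p) U"
proof (induction k arbitrary: f g)
  case 0 then show ?case by (simp add: continuous_on_add)
next
  case (Suc k)
  show ?case
    by (rule Ck_on_SucI[OF assms has_derivative_add[OF Ck_on_SucD(1)[OF Suc.prems(1)] Ck_on_SucD(1)[OF Suc.prems(2)]]])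
       (auto intro: Suc.IH Ck_on_SucD(2)[OF Suc.prems(1)] Ck_on_SucD(2)[OF Suc.prems(2)])
qed

text \<open>The product rule mixes a derivative of one factor with the undifferentiated other factor, which
  is the reason that \<open>Ck_on_Suc_imp\<close> is needed here.\<close>

lemma Ck_on_scaleR:
  fixes f :: "'a::real_normed_vector \<Rightarrow> real"
  assumes "open U"
  shows "Ck_on k f U \<Longrightarrow> Ck_on k g U \<Longrightarrow> Ck_on k (\<lambda>p. f p *\<^sub>R g p) U"
proof (induction k arbitrary: f g)
  case 0 then show ?case by (simp add: continuous_on_scaleR)
next
  case (Suc k)
  have "Ck_on k (\<lambda>p. f p *\<^sub>R frechet_derivative g (at p) d + frechet_derivative f (at p) d *\<^sub>R g p) U" for d
    by (intro Ck_on_add[OF assms] Suc.IH Ck_on_SucD(2)[OF Suc.prems(1)] Ck_on_SucD(2)[OF Suc.prems(2)]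
      Ck_on_Suc_imp[OF Suc.prems(1)] Ck_on_Suc_imp[OF Suc.prems(2)])
  then show ?case
    by (intro Ck_on_SucI[OF assms has_derivative_scaleR[OF Ck_on_SucD(1)[OF Suc.prems(1)] Ck_on_SucD(1)[OF Suc.prems(2)]]])
qed

text \<open>The derivative of \<open>1/f\<close> is a product of the derivative of \<open>f\<close> with copies of \<open>1/f\<close>
  itself, so the induction hypothesis for \<open>1/f\<close> closes the step.\<close>

lemma Ck_on_inverse:
  fixes f :: "'a::real_normed_vector \<Rightarrow> real"
  assumes "open U" and "\<And>p. p \<in> U \<Longrightarrow> f p \<noteq> 0"
  shows "Ck_on k f U \<Longrightarrow> Ck_on k (\<lambda>p. inverse (f p)) U"
proof (induction k)
  case 0 then show ?case using assms by (simp add: continuous_on_inverse)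
next
  case (Suc k)
  note inv = Suc.IH[OF Ck_on_Suc_imp[OF Suc.prems]]
  have "Ck_on k (\<lambda>p. - (inverse (f p) *\<^sub>R frechet_derivative f (at p) d *\<^sub>R inverse (f p))) U" for d
    by (intro Ck_on_linear[OF assms(1) bounded_linear_minus[OF bounded_linear_ident]]
        Ck_on_scaleR assms(1) inv Ck_on_SucD(2)[OF Suc.prems])
  then show ?case
    by (intro Ck_on_SucI[OF assms(1) Deriv.has_derivative_inverse[OF assms(2) Ck_on_SucD(1)[OF Suc.prems]]])
      (auto simp: mult.assoc)
qed
lemma Ck_on_diff:
  assumes "open U" "Ck_on k f U" "Ck_on k g U"
  shows "Ck_on k (\<lambda>p. f p - g p) U"
  using Ck_on_add[OF assms(1,2) Ck_on_linear[OF assms(1)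
      bounded_linear_minus[OF bounded_linear_ident] assms(3)]]
  by simp

lemma Ck_on_mult:
  fixes f g :: "'a::real_normed_vector \<Rightarrow> real"
  assumes "open U" "Ck_on k f U" "Ck_on k g U"
  shows "Ck_on k (\<lambda>p. f p * g p) U"
  using Ck_on_scaleR[OF assms] by simp

lemma Ck_on_power2:
  fixes f :: "'a::real_normed_vector \<Rightarrow> real"
  assumes "open U" "Ck_on k f U"
  shows "Ck_on k (\<lambda>p. (f p)\<^sup>2) U"
  using Ck_on_mult[OF assms assms(2)] by (simp add: power2_eq_square)

lemma Ck_on_divide:
  fixes f g :: "'a::real_normed_vector \<Rightarrow> real"
  assumes "open U" "Ck_on k f U" "Ck_on k g U" "\<And>p. p \<in> U \<Longrightarrow> g p \<noteq> 0"
  shows "Ck_on k (\<lambda>p. f p / g p) U"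
  using Ck_on_mult[OF assms(1,2) Ck_on_inverse[OF assms(1,4,3)]]
  by (simp add: divide_inverse)

lemma Ck_on_sum:
  assumes "open U" "finite I" "\<And>i. i \<in> I \<Longrightarrow> Ck_on k (f i) U"
  shows "Ck_on k (\<lambda>p. \<Sum>i\<in>I. f i p) U"
  using assms(2,3)
  by (induction I rule: finite_induct) (auto intro: Ck_on_add Ck_on_const assms(1))

lemma Ck_on_nth:
  assumes "open U" "Ck_on k f U"
  shows "Ck_on k (\<lambda>p. f p $ i) U"
  by (rule Ck_on_linear[OF assms(1) bounded_linear_vec_nth assms(2)])

lemma Ck_on_vec:
  fixes f :: "'a::real_normed_vector \<Rightarrow> real^'n"
  assumes "open U" "\<And>i. Ck_on k (\<lambda>p. f p $ i) U"
  shows "Ck_on k f U"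
proof -
  have "Ck_on k (\<lambda>p. \<Sum>i\<in>UNIV. (f p $ i) *\<^sub>R axis i (1::real)) U"
    by (intro Ck_on_sum Ck_on_scaleR Ck_on_const assms) simp
  moreover have "(\<lambda>p. \<Sum>i\<in>UNIV. (f p $ i) *\<^sub>R axis i (1::real)) = f"
    using basis_expansion[of "f _"] by (simp add: scalar_mult_eq_scaleR)
  ultimately show ?thesis by simp
qed

lemma Ck_on_Pair:
  assumes "open U" "Ck_on k f U" "Ck_on k g U"
  shows "Ck_on k (\<lambda>p. (f p, g p)) U"
proof -
  have "Ck_on k (\<lambda>p. (f p, 0) + (0, g p)) U"
    by (intro Ck_on_add assms Ck_on_linear[where L = "\<lambda>y. (y, 0)"]
        Ck_on_linear[where L = "\<lambda>y. (0, y)"] bounded_linear_Pair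
        bounded_linear_ident bounded_linear_zero)
  then show ?thesis by simp
qed

lemmas Ck_on_intros = Ck_on_const Ck_on_add Ck_on_diff Ck_on_mult Ck_on_power2 Ck_on_nth

lemma partial_eq:
  assumes "(f has_derivative f') (at p)"
  shows "partial i f p = f' (axis i 1)"
proof -
  have "(f has_derivative f') (at (p + 0 *\<^sub>R axis i (1::real)))"
    using assms by simp
  moreover have "((\<lambda>t. p + t *\<^sub>R axis i (1::real)) has_derivative (\<lambda>t. t *\<^sub>R axis i 1)) (at 0)"
    by (auto intro!: derivative_eq_intros)
  ultimately have "((\<lambda>t. f (p + t *\<^sub>R axis i 1)) has_derivative (\<lambda>t. f' (t *\<^sub>R axis i 1))) (at 0)"
    using has_derivative_compose by blast
  moreover have "f' (t *\<^sub>R axis i 1) = t *\<^sub>R f' (axis i 1)" for t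
    using has_derivative_bounded_linear[OF assms] by (simp add: linear_simps)
  ultimately show ?thesis
    unfolding partial_def by (intro vector_derivative_at) (simp add: has_vector_derivative_def)
qed

section \<open>The pseudo vector product\<close>

lemma vector_4: "(vector [a,b,c,d] :: 'a::zero^4)$1 = a"
 "(vector [a,b,c,d] :: 'a::zero^4)$2 = b"
 "(vector [a,b,c,d] :: 'a::zero^4)$3 = c"
 "(vector [a,b,c,d] :: 'a::zero^4)$4 = d"
  by (simp_all add: vector_def)

lemma det_4:
  "det (A::'a::comm_ring_1^4^4) =
     A$1$1 * (A$2$2 * (A$3$3 * A$4$4 - A$3$4 * A$4$3) - A$2$3 * (A$3$2 * A$4$4 - A$3$4 * A$4$2) + A$2$4 * (A$3$2 * A$4$3 - A$3$3 * A$4$2))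
   - A$1$2 * (A$2$1 * (A$3$3 * A$4$4 - A$3$4 * A$4$3) - A$2$3 * (A$3$1 * A$4$4 - A$3$4 * A$4$1) + A$2$4 * (A$3$1 * A$4$3 - A$3$3 * A$4$1))
   + A$1$3 * (A$2$1 * (A$3$2 * A$4$4 - A$3$4 * A$4$2) - A$2$2 * (A$3$1 * A$4$4 - A$3$4 * A$4$1) + A$2$4 * (A$3$1 * A$4$2 - A$3$2 * A$4$1))
   - A$1$4 * (A$2$1 * (A$3$2 * A$4$3 - A$3$3 * A$4$2) - A$2$2 * (A$3$1 * A$4$3 - A$3$3 * A$4$1) + A$2$3 * (A$3$1 * A$4$2 - A$3$2 * A$4$1))"
proof -
  have f: "finite {2::4, 3, 4}" "1 \<notin> {2::4, 3, 4}" "finite {3::4, 4}" "2 \<notin> {3::4, 4}" "finite {4::4}" "3 \<notin> {4::4}"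
    by auto
  show ?thesis
    unfolding det_def UNIV_4
    unfolding sum_over_permutations_insert[OF f(1,2)]
    unfolding sum_over_permutations_insert[OF f(3,4)]
    unfolding sum_over_permutations_insert[OF f(5,6)]
    unfolding permutes_sing
    by (simp add: sign_swap_id permutation_swap_id sign_compose sign_id algebra_simps
       permutation_compose transpose_eq_iff)
qed

text \<open>The pseudo inner product is nondegenerate, so testing against all \<open>w\<close> determines the
  vector that the definite description asks for.\<close>

lemma mink_wedge_eqI:
  assumes "\<And>w. mink w a = det (vector [w, x, y, z] :: real^4^4)"
  shows "mink_wedge x y z = a"
  unfolding mink_wedge_def
proof (rule the_equality)
  show "\<forall>w. mink w a = det (vector [w, x, y, z] :: real^4^4)"
    using assms by blast
next
  fix b assume b: "\<forall>w. mink w b = det (vector [w, x, y, z] :: real^4^4)"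
  have "mink (axis i 1) b = mink (axis i 1) a" for i
    using b assms by simp
  from this[of 1] this[of 2] this[of 3] this[of 4] show "b = a"
    by (simp add: mink_def axis_def vec_eq_iff forall_4)
qed

lemma mink_scaleR: "mink (c *\<^sub>R x) (d *\<^sub>R y) = c * d * mink x y"
  unfolding mink_def by (simp add: algebra_simps)

section \<open>The Poincare ball and the hyperboloid\<close>

definition ball_defect :: "real^3 \<Rightarrow> real" where
  "ball_defect x = 1 - (x$1)\<^sup>2 - (x$2)\<^sup>2 - (x$3)\<^sup>2"

lemma ball_defect_pos: "x \<in> D3 \<Longrightarrow> ball_defect x > 0"
  by (simp add: D3_def ball_defect_def)

lemma ball_to_hyperboloid_eq:
  "ball_to_hyperboloid x = (1 / ball_defect x) *\<^sub>R
     vector [1 + (x$1)\<^sup>2 + (x$2)\<^sup>2 + (x$3)\<^sup>2, 2 * x$1, 2 * x$2, 2 * x$3]"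
  by (simp add: ball_to_hyperboloid_def ball_defect_def)

lemma ball_to_hyperboloid_in_H3:
  assumes "x \<in> D3"
  shows "ball_to_hyperboloid x \<in> H3"
proof -
  let ?G = "vector [1 + (x$1)\<^sup>2 + (x$2)\<^sup>2 + (x$3)\<^sup>2, 2 * x$1, 2 * x$2, 2 * x$3] :: real^4"
  have d: "ball_defect x > 0" by (rule ball_defect_pos[OF assms])
  have "mink ?G ?G = - (ball_defect x)\<^sup>2"
    unfolding mink_def vector_4 ball_defect_def by algebra
  then have "mink (ball_to_hyperboloid x) (ball_to_hyperboloid x) = -1"
    using d by (simp add: ball_to_hyperboloid_eq mink_scaleR power2_eq_square)
  moreover have "1 + (x$1)\<^sup>2 + (x$2)\<^sup>2 + (x$3)\<^sup>2 > 0"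
    by (simp add: add_pos_nonneg)
  then have "ball_to_hyperboloid x $ 1 > 0"
    using d by (simp add: ball_to_hyperboloid_eq vector_4)
  ultimately show ?thesis by (simp add: H3_def)
qed

lemma pqrs_linear_combination:
  "pqrs x (a *\<^sub>R y + b *\<^sub>R z) = a *\<^sub>R pqrs x y + b *\<^sub>R pqrs x z"
  unfolding vec_eq_iff forall_4 pqrs_def by (simp add: vector_4 algebra_simps)

text \<open>A polynomial identity that expresses conformality of \<open>ball_to_hyperboloid\<close>.\<close>

lemma mink_pqrs: "mink (pqrs x y) (pqrs x z) = (ball_defect x)\<^sup>2 * (y \<bullet> z)"
  unfolding mink_def pqrs_def vector_4 ball_defect_def inner_vec_def sum_3 inner_real_def
  by algebra

lemma mink_ball_to_hyperboloid_pqrs: "mink (ball_to_hyperboloid x) (pqrs x y) = 0"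
proof -
  have "mink (vector [1 + (x$1)\<^sup>2 + (x$2)\<^sup>2 + (x$3)\<^sup>2, 2 * x$1, 2 * x$2, 2 * x$3]) (pqrs x y) = 0"
    unfolding mink_def pqrs_def vector_4 by algebra
  then show ?thesis
    unfolding ball_to_hyperboloid_eq
    using mink_scaleR[of "1 / ball_defect x" _ 1] by simp
qed

text \<open>The triple product identity with denominators cleared, so that it is polynomial in all
  coordinates. The sign is that of the odd permutation moving \<open>w\<close>, which plays the part of the
  normal direction, behind the three other rows.\<close>

lemma det_pqrs:
  "det (vector [w, vector [1 + (x$1)\<^sup>2 + (x$2)\<^sup>2 + (x$3)\<^sup>2, 2 * x$1, 2 * x$2, 2 * x$3],
      pqrs x a, pqrs x b] :: real^4^4)
   = - (ball_defect x)\<^sup>2 * mink w (pqrs x (cross3 a b))"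
  unfolding det_4 mink_def pqrs_def vector_4 ball_defect_def cross3_def vector_3 by algebra

lemma mink_wedge_pqrs:
  assumes "ball_defect x \<noteq> 0"
  shows "mink_wedge (ball_to_hyperboloid x) (c *\<^sub>R pqrs x a) (c *\<^sub>R pqrs x b)
         = (- c\<^sup>2 * ball_defect x) *\<^sub>R pqrs x (cross3 a b)"
proof (rule mink_wedge_eqI)
  fix w :: "real^4"
  have scale: "det (vector [w, d *\<^sub>R g, c *\<^sub>R y, c *\<^sub>R z] :: real^4^4)
      = d * c\<^sup>2 * det (vector [w, g, y, z] :: real^4^4)" for d and g y z :: "real^4"
    unfolding det_4 vector_4 vector_scaleR_component real_scaleR_def
    by (simp add: algebra_simps power2_eq_square)
  show "mink w ((- c\<^sup>2 * ball_defect x) *\<^sub>R pqrs x (cross3 a b))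
      = det (vector [w, ball_to_hyperboloid x, c *\<^sub>R pqrs x a, c *\<^sub>R pqrs x b] :: real^4^4)"
    unfolding ball_to_hyperboloid_eq scale det_pqrs
    using assms mink_scaleR[of 1 w "- c\<^sup>2 * ball_defect x"]
    by (simp add: power2_eq_square)
qed

lemma has_derivative_ball_to_hyperboloid:
  assumes "ball_defect x \<noteq> 0"
  shows "(ball_to_hyperboloid has_derivative (\<lambda>y. (2 / (ball_defect x)\<^sup>2) *\<^sub>R pqrs x y)) (at x)"
proof -
  have nth: "((\<lambda>x. x $ i) has_derivative (\<lambda>y. y $ i)) (at x)" for i :: 3
    by (rule bounded_linear_imp_has_derivative[OF bounded_linear_vec_nth])
  have defect: "(ball_defect has_derivative
      (\<lambda>y. - 2 * (x$1 * y$1 + x$2 * y$2 + x$3 * y$3))) (at x)"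
    unfolding ball_defect_def[abs_def]
    by (rule derivative_eq_intros nth refl | simp add: algebra_simps)+
  \<comment> \<open>The quotient rule with its numerator as a side condition: what remains to be checked for each
    coordinate is a polynomial identity.\<close>
  have quotient: "((\<lambda>x. 1 / ball_defect x * g x) has_derivative
      (\<lambda>y. 2 / (ball_defect x)\<^sup>2 * h y)) (at x)"
    if g: "(g has_derivative g') (at x)"
      and h: "\<And>y. g' y * ball_defect x + g x * (2 * (x$1 * y$1 + x$2 * y$2 + x$3 * y$3)) = 2 * h y"
    for g g' h
  proof -
    have "((\<lambda>x. g x / ball_defect x) has_derivative
        (\<lambda>y. (g' y * ball_defect x - g x * (- 2 * (x$1 * y$1 + x$2 * y$2 + x$3 * y$3)))
              / (ball_defect x * ball_defect x))) (at x)"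
      by (rule has_derivative_divide'[OF g defect assms])
    moreover have "(g' y * ball_defect x - g x * (- 2 * (x$1 * y$1 + x$2 * y$2 + x$3 * y$3)))
        / (ball_defect x * ball_defect x) = 2 / (ball_defect x)\<^sup>2 * h y" for y
      using h[of y] by (simp add: power2_eq_square assms algebra_simps)
    ultimately show ?thesis by simp
  qed
  have first: "((\<lambda>x. 1 + (x$1)\<^sup>2 + (x$2)\<^sup>2 + (x$3)\<^sup>2) has_derivative
      (\<lambda>y. 2 * (x$1 * y$1 + x$2 * y$2 + x$3 * y$3))) (at x)" for x :: "real^3"
    by (rule derivative_eq_intros bounded_linear_imp_has_derivative[OF bounded_linear_vec_nth] refl
        | simp add: algebra_simps)+
  have rest: "((\<lambda>x. 2 * x $ i) has_derivative (\<lambda>y. 2 * y $ i)) (at x)" for i :: 3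
    by (rule has_derivative_mult_right[OF nth])
  have "((\<lambda>x. ball_to_hyperboloid x $ i) has_derivative
      (\<lambda>y. ((2 / (ball_defect x)\<^sup>2) *\<^sub>R pqrs x y) $ i)) (at x)" for i
  proof -
    have "\<forall>i. ((\<lambda>x. ball_to_hyperboloid x $ i) has_derivative
      (\<lambda>y. ((2 / (ball_defect x)\<^sup>2) *\<^sub>R pqrs x y) $ i)) (at x)"
      unfolding forall_4 ball_to_hyperboloid_eq pqrs_def vector_scaleR_component vector_4
        real_scaleR_def
      by (intro conjI quotient[OF first] quotient[OF rest]; unfold ball_defect_def; algebra)
    then show ?thesis by blast
  qed
  then show ?thesis
    by (subst has_derivative_componentwise_within) (auto simp: Basis_vec_def inner_axis)
qed

text \<open>The radicand is \<open>\<langle>pqrs x y, pqrs x y\<rangle>\<close>, a perfect square when \<open>y\<close> is a unit vector.\<close>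

lemma mink_normalize_pqrs:
  assumes "x \<in> D3" "norm y = 1"
  shows "mink_normalize (pqrs x y) = (1 / ball_defect x) *\<^sub>R pqrs x y"
proof -
  have "- (w$1)\<^sup>2 + (w$2)\<^sup>2 + (w$3)\<^sup>2 + (w$4)\<^sup>2 = mink w w" for w
    by (simp add: mink_def power2_eq_square)
  moreover have "y \<bullet> y = 1" using assms(2) by (simp add: dot_square_norm)
  ultimately show ?thesis
    using ball_defect_pos[OF assms(1)] by (simp add: mink_normalize_def mink_pqrs)
qed

lemma Ck_on_ball_defect:
  assumes "open U" "Ck_on k x U"
  shows "Ck_on k (\<lambda>p. ball_defect (x p)) U"
  unfolding ball_defect_def by (intro Ck_on_intros assms)

lemma Ck_on_ball_to_hyperboloid:
  assumes "open U" "Ck_on k x U" "\<And>p. p \<in> U \<Longrightarrow> ball_defect (x p) \<noteq> 0"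
  shows "Ck_on k (\<lambda>p. ball_to_hyperboloid (x p)) U"
proof (rule Ck_on_vec[OF assms(1)])
  fix i :: 4
  have "\<forall>i. Ck_on k (\<lambda>p. (vector [1 + (x p$1)\<^sup>2 + (x p$2)\<^sup>2 + (x p$3)\<^sup>2,
      2 * x p$1, 2 * x p$2, 2 * x p$3] :: real^4) $ i) U"
    unfolding forall_4 vector_4 by (intro conjI Ck_on_intros assms)
  then have "Ck_on k (\<lambda>p. 1 / ball_defect (x p) * (vector [1 + (x p$1)\<^sup>2 + (x p$2)\<^sup>2 + (x p$3)\<^sup>2,
      2 * x p$1, 2 * x p$2, 2 * x p$3] :: real^4) $ i) U"
    by (intro Ck_on_mult Ck_on_divide Ck_on_const Ck_on_ball_defect assms) auto
  then show "Ck_on k (\<lambda>p. ball_to_hyperboloid (x p) $ i) U"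
    by (simp add: ball_to_hyperboloid_eq)
qed

lemma Ck_on_pqrs:
  assumes "open U" "Ck_on k x U" "Ck_on k y U"
  shows "Ck_on k (\<lambda>p. pqrs (x p) (y p)) U"
proof (rule Ck_on_vec[OF assms(1)])
  fix i :: 4
  have "\<forall>i. Ck_on k (\<lambda>p. pqrs (x p) (y p) $ i) U"
    unfolding forall_4 pqrs_def vector_4 by (intro conjI Ck_on_intros assms)
  then show "Ck_on k (\<lambda>p. pqrs (x p) (y p) $ i) U" by blast
qed

lemma Ck_on_mink_normalize_pqrs:
  assumes "open U" "Ck_on k x U" "Ck_on k y U"
    and "\<And>p. p \<in> U \<Longrightarrow> x p \<in> D3" "\<And>p. p \<in> U \<Longrightarrow> norm (y p) = 1"
  shows "Ck_on k (\<lambda>p. mink_normalize (pqrs (x p) (y p))) U"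
proof (rule Ck_on_cong[OF assms(1)])
  have "ball_defect (x p) \<noteq> 0" if "p \<in> U" for p
    using ball_defect_pos[OF assms(4)[OF that]] by simp
  then show "Ck_on k (\<lambda>p. (1 / ball_defect (x p)) *\<^sub>R pqrs (x p) (y p)) U"
    by (intro Ck_on_scaleR Ck_on_divide Ck_on_const Ck_on_ball_defect Ck_on_pqrs assms(1-3))
qed (simp add: mink_normalize_pqrs assms)

section \<open>Transfer of framed surfaces\<close>

theorem proposition4p2:
  fixes U :: "(real^2) set" and x n1 n2 :: "real^2 \<Rightarrow> real^3"
  assumes "open U" and "simply_connected U"
    and "generalized_framed_surface U x n1 n2"
    and "\<forall>p\<in>U. x p \<in> D3"
  shows "hyperbolic_generalized_framed_surface U
           (\<lambda>p. ball_to_hyperboloid (x p))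
           (\<lambda>p. mink_normalize (pqrs (x p) (n1 p)))
           (\<lambda>p. mink_normalize (pqrs (x p) (n2 p)))"
proof -
  let ?\<delta> = "\<lambda>p. ball_defect (x p)"
  let ?F = "\<lambda>p. ball_to_hyperboloid (x p)"
  let ?\<nu>1 = "\<lambda>p. mink_normalize (pqrs (x p) (n1 p))"
  let ?\<nu>2 = "\<lambda>p. mink_normalize (pqrs (x p) (n2 p))"
  obtain \<alpha> \<beta> :: "real^2 \<Rightarrow> real" where smooth: "smooth_on (\<lambda>p. (x p, n1 p, n2 p)) U"
    and Delta: "\<And>p. p \<in> U \<Longrightarrow> (n1 p, n2 p) \<in> Delta"
    and coeffs: "smooth_on \<alpha> U" "smooth_on \<beta> U"
    and cross: "\<And>p. p \<in> U \<Longrightarrow>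
      cross3 (partial_u x p) (partial_v x p) = \<alpha> p *\<^sub>R n1 p + \<beta> p *\<^sub>R n2 p"
    using assms(3) unfolding generalized_framed_surface_def by blast
  have unit: "norm (n1 p) = 1" "norm (n2 p) = 1" "n1 p \<bullet> n2 p = 0" if "p \<in> U" for p
    using Delta[OF that] by (auto simp: Delta_def)
  have D3: "x p \<in> D3" if "p \<in> U" for p using assms(4) that by blast
  have pos: "?\<delta> p > 0" if "p \<in> U" for p using ball_defect_pos[OF D3[OF that]] .
  then have nz: "?\<delta> p \<noteq> 0" if "p \<in> U" for p using that by force
  have Ck: "Ck_on k x U" "Ck_on k n1 U" "Ck_on k n2 U" for k
  proof -
    have *: "Ck_on k (\<lambda>p. (x p, n1 p, n2 p)) U" using smooth by (simp add: smooth_on_def)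
    note ** = Ck_on_linear[OF assms(1) bounded_linear_snd *]
    show "Ck_on k x U" using Ck_on_linear[OF assms(1) bounded_linear_fst *] by simp
    show "Ck_on k n1 U" using Ck_on_linear[OF assms(1) bounded_linear_fst **] by simp
    show "Ck_on k n2 U" using Ck_on_linear[OF assms(1) bounded_linear_snd **] by simp
  qed
  have \<nu>: "?\<nu>1 p = (1 / ?\<delta> p) *\<^sub>R pqrs (x p) (n1 p)" "?\<nu>2 p = (1 / ?\<delta> p) *\<^sub>R pqrs (x p) (n2 p)"
    if "p \<in> U" for p
    by (simp_all add: mink_normalize_pqrs D3 unit that)
  have frame_smooth: "smooth_on (\<lambda>p. (?F p, ?\<nu>1 p, ?\<nu>2 p)) U"
    unfolding smooth_on_def
    by (intro allI Ck_on_Pair Ck_on_ball_to_hyperboloid Ck_on_mink_normalize_pqrs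
        assms(1) Ck nz unit D3)
  have frame_in: "(?F p, ?\<nu>1 p, ?\<nu>2 p) \<in> H3 \<times> Delta5" if "p \<in> U" for p
    using ball_to_hyperboloid_in_H3[OF D3[OF that]] nz[OF that] unit[OF that]
    by (simp add: \<nu>[OF that] Delta5_def S31_def mink_scaleR mink_pqrs dot_square_norm
        power2_eq_square)
  have frame_tangent: "mink (?F p) (?\<nu>1 p) = 0" "mink (?F p) (?\<nu>2 p) = 0" if "p \<in> U" for p
    using mink_scaleR[of 1 "?F p"] by (simp_all add: \<nu>[OF that] mink_ball_to_hyperboloid_pqrs)
  have coeffs_smooth: "smooth_on (\<lambda>p. - 4 * a p / (?\<delta> p)\<^sup>2) U" if "smooth_on a U" for a
    using that nz unfolding smooth_on_def
    by (intro allI Ck_on_divide Ck_on_mult Ck_on_const Ck_on_power2 Ck_on_ball_defect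
        assms(1) Ck) auto
  have wedge: "mink_wedge (?F p) (partial_u ?F p) (partial_v ?F p)
      = (- 4 * \<alpha> p / (?\<delta> p)\<^sup>2) *\<^sub>R ?\<nu>1 p + (- 4 * \<beta> p / (?\<delta> p)\<^sup>2) *\<^sub>R ?\<nu>2 p"
    if p: "p \<in> U" for p
  proof -
    let ?c = "2 / (?\<delta> p)\<^sup>2"
    have dx: "(x has_derivative frechet_derivative x (at p)) (at p)"
      using Ck_on_SucD(1)[OF Ck(1) p] .
    have "partial i ?F p = ?c *\<^sub>R pqrs (x p) (partial i x p)" for i
      using partial_eq[OF has_derivative_compose[OF dx
            has_derivative_ball_to_hyperboloid[OF nz[OF p]]]] partial_eq[OF dx]
      by simp
    then have "mink_wedge (?F p) (partial_u ?F p) (partial_v ?F p)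
        = (- ?c\<^sup>2 * ?\<delta> p) *\<^sub>R pqrs (x p) (\<alpha> p *\<^sub>R n1 p + \<beta> p *\<^sub>R n2 p)"
      by (simp only: mink_wedge_pqrs[OF nz[OF p]] cross[OF p])
    moreover have "- ?c\<^sup>2 * ?\<delta> p * a = (- 4 * a / (?\<delta> p)\<^sup>2) * (1 / ?\<delta> p)" for a
      using nz[OF p] by (simp add: power2_eq_square)
    ultimately show ?thesis
      by (simp only: pqrs_linear_combination scaleR_add_right scaleR_scaleR \<nu>[OF p])
  qed
  show ?thesis
    unfolding hyperbolic_generalized_framed_surface_def
  proof (intro conjI ballI exI)
    show "smooth_on (\<lambda>p. - 4 * \<alpha> p / (?\<delta> p)\<^sup>2) U" "smooth_on (\<lambda>p. - 4 * \<beta> p / (?\<delta> p)\<^sup>2) U"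
      by (rule coeffs_smooth[OF coeffs(1)], rule coeffs_smooth[OF coeffs(2)])
  qed (fact frame_smooth frame_in frame_tangent wedge)+
qed

end
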